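(* There exists a set $A \subseteq \mathbb{C}$ such that every element of $A$ is a chromatic root (i.e. a zero of the chromatic polynomial of some finite simple graph), $A$ is dense in the complex plane $\mathbb{C}$, and $A$ is closed under multiplication by natural numbers, i.e. $p\alpha \in A$ for every $\alpha\in A$ and every positive integer $p$.
   Context: For a finite simple graph $G$, the chromatic polynomial $P_G(X)$ is the unique monic polynomial whose value at each $q\in\mathbb{N}$ is the number of proper $q$-colourings of $G$. A complex number is a chromatic root if it is a zero of $P_G(X)$ for some finite simple graph $G$. *)

theory Defs
  imports "HOL-Analysis.Analysis" "HOL-Computational_Algebra.Polynomial"
begin

definition finite_simple_graph :: "'a set \<Rightarrow> 'a set set \<Rightarrow> bool" where
  "finite_simple_graph V E \<longleftrightarrow> finite V \<and> (\<forall>e\<in>E. e \<subseteq> V \<and> card e = 2)"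

text \<open>Using extensional functions makes colourings differ only by their values on \<open>V\<close>.\<close>

definition proper_colourings :: "'a set \<Rightarrow> 'a set set \<Rightarrow> nat \<Rightarrow> ('a \<Rightarrow> nat) set" where
  "proper_colourings V E q =
     {c \<in> V \<rightarrow>\<^sub>E {..<q}. \<forall>u v. {u, v} \<in> E \<longrightarrow> c u \<noteq> c v}"

definition is_chromatic_poly :: "'a set \<Rightarrow> 'a set set \<Rightarrow> complex poly \<Rightarrow> bool" where
  "is_chromatic_poly V E P \<longleftrightarrow>
     lead_coeff P = 1 \<and>
     (\<forall>q::nat. poly P (of_nat q) = of_nat (card (proper_colourings V E q)))"

text \<open>For finite simple graphs this description is proper: see \<open>is_chromatic_poly_ex1\<close> below.\<close>

definition chromatic_poly :: "'a set \<Rightarrow> 'a set set \<Rightarrow> complex poly" where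
  "chromatic_poly V E = (THE P. is_chromatic_poly V E P)"

text \<open>Every finite graph is isomorphic to one whose vertices are natural numbers, so
  restricting the vertex type to \<^typ>\<open>nat\<close> loses no chromatic roots.\<close>

definition chromatic_root :: "complex \<Rightarrow> bool" where
  "chromatic_root z \<longleftrightarrow>
     (\<exists>(V :: nat set) E. finite_simple_graph V E \<and> poly (chromatic_poly V E) z = 0)"

lemma colouring_count_poly:
  assumes "finite R" "finite V" "R \<subseteq> V \<times> V"
  shows "\<exists>p :: complex poly. degree p \<le> card V \<and> (irrefl R \<longrightarrow> coeff p (card V) = 1) \<and>
    (\<forall>q::nat. poly p (of_nat q) =
      of_nat (card {c \<in> V \<rightarrow>\<^sub>E {..<q}. \<forall>(u, v)\<in>R. c u \<noteq> c v}))"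
  using assms
proof (induction "card R" arbitrary: R V rule: less_induct)
  case less
  define C where "C V R q = {c \<in> V \<rightarrow>\<^sub>E {..<q}. \<forall>(u, v)\<in>R. c u \<noteq> c v}"
    for V :: "'a set" and R :: "('a \<times> 'a) set" and q :: nat
  show ?case
  proof (cases "R = {}")
    case True
    with less show ?thesis
      by (intro exI[of _ "monom 1 (card V)"]) (simp add: degree_monom_eq poly_monom card_funcsetE)
  next
    case False
    then obtain u v where uv: "(u, v) \<in> R" by auto
    define R0 where "R0 = R - {(u, v)}"
    have R: "R = insert (u, v) R0" and cR0: "card R0 < card R" and fR0: "finite R0"
      and R0V: "R0 \<subseteq> V \<times> V" and uV: "u \<in> V" and vV: "v \<in> V"
      using uv less.prems card_Diff1_less[OF _ uv] by (auto simp: R0_def)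
    show ?thesis
    proof (cases "u = v")
      case True
      then have "\<not> irrefl R" using uv by (auto simp: irrefl_def)
      moreover have E: "{c \<in> V \<rightarrow>\<^sub>E {..<q}. \<forall>(u, v)\<in>R. c u \<noteq> c v} = {}" for q :: nat
        using uv True by auto
      ultimately show ?thesis unfolding E by (intro exI[of _ 0]) simp
    next
      case False
      define W where "W = V - {v}"
      define f where "f = (\<lambda>x. if x = v then u else x)"
      define R1 where "R1 = map_prod f f ` R0"
      have fR1: "finite R1" and R1W: "R1 \<subseteq> W \<times> W" and fW: "finite W"
        using fR0 R0V uV False less.prems by (auto simp: R1_def f_def W_def split: if_splits)
      have cR1: "card R1 < card R"
        using card_image_le[OF fR0, of "map_prod f f"] cR0 by (simp add: R1_def)
      have cW: "card W < card V"
        using less.prems vV unfolding W_def by (intro card_Diff1_less) auto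
      obtain p0 where p0: "degree p0 \<le> card V" "irrefl R0 \<longrightarrow> coeff p0 (card V) = 1"
        "\<And>q. poly p0 (of_nat q) = (of_nat (card (C V R0 q)) :: complex)"
        using less.hyps[OF cR0 fR0 less.prems(2) R0V] unfolding C_def by blast
      obtain p1 where p1: "degree p1 \<le> card W"
        "\<And>q. poly p1 (of_nat q) = (of_nat (card (C W R1 q)) :: complex)"
        using less.hyps[OF cR1 fR1 fW R1W] unfolding C_def by blast
      have count: "poly (p0 - p1) (of_nat q) = of_nat (card (C V R q))" for q
      proof -
        define D where "D = {c \<in> C V R0 q. c u = c v}"
        have finC: "finite (C V R0 q)"
          using less.prems unfolding C_def
          by (intro finite_subset[OF _ finite_PiE[of V "\<lambda>_. {..<q}"]]) auto
        have CD: "C V R q = C V R0 q - D" unfolding C_def D_def R by auto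
        have DC: "D \<subseteq> C V R0 q" unfolding D_def by auto
        have ext: "c (f x) = c x" if "c \<in> D" for c x
          using that by (simp add: D_def f_def)
        have bij: "bij_betw (\<lambda>c. restrict c W) D (C W R1 q)"
        proof (rule bij_betw_byWitness[where f' = "\<lambda>c. \<lambda>x\<in>V. c (f x)"])
          show "\<forall>c\<in>D. (\<lambda>x\<in>V. restrict c W (f x)) = c"
          proof
            fix c assume c: "c \<in> D"
            then have "c \<in> extensional V" by (auto simp: D_def C_def PiE_def)
            moreover have "f x \<in> W" if "x \<in> V" for x
              using that uV False by (auto simp: f_def W_def)
            ultimately show "(\<lambda>x\<in>V. restrict c W (f x)) = c"
              using ext[OF c] by (auto simp: fun_eq_iff extensional_def)
          qed
          show "\<forall>c\<in>C W R1 q. restrict (\<lambda>x\<in>V. c (f x)) W = c"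
          proof
            fix c assume "c \<in> C W R1 q"
            then have "c \<in> extensional W" by (auto simp: C_def PiE_def)
            then show "restrict (\<lambda>x\<in>V. c (f x)) W = c"
              by (auto simp: fun_eq_iff extensional_def W_def f_def)
          qed
          show "(\<lambda>c. restrict c W) ` D \<subseteq> C W R1 q"
          proof safe
            fix c assume c: "c \<in> D"
            then have "c \<in> V \<rightarrow>\<^sub>E {..<q}" and n: "\<And>a b. (a, b) \<in> R0 \<Longrightarrow> c a \<noteq> c b"
              by (auto simp: D_def C_def)
            then have "restrict c W \<in> W \<rightarrow>\<^sub>E {..<q}" by (auto simp: W_def)
            moreover have "restrict c W a \<noteq> restrict c W b" if ab: "(a, b) \<in> R1" for a b
            proof -
              obtain a' b' where "(a', b') \<in> R0" "a = f a'" "b = f b'"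
                using ab by (auto simp: R1_def)
              moreover have "a \<in> W" "b \<in> W" using ab R1W by auto
              ultimately show ?thesis using n ext[OF c] by simp
            qed
            ultimately show "restrict c W \<in> C W R1 q"
              unfolding C_def by blast
          qed
          show "(\<lambda>c. \<lambda>x\<in>V. c (f x)) ` C W R1 q \<subseteq> D"
          proof safe
            fix c assume "c \<in> C W R1 q"
            then have c: "c \<in> W \<rightarrow>\<^sub>E {..<q}" and n: "\<And>a b. (a, b) \<in> R1 \<Longrightarrow> c a \<noteq> c b"
              by (auto simp: C_def)
            have "f x \<in> W" if "x \<in> V" for x
              using that uV False by (auto simp: f_def W_def)
            then have "(\<lambda>x\<in>V. c (f x)) \<in> V \<rightarrow>\<^sub>E {..<q}" using c by auto
            moreover have "(\<lambda>x\<in>V. c (f x)) a \<noteq> (\<lambda>x\<in>V. c (f x)) b" if ab: "(a, b) \<in> R0" for a b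
            proof -
              have "(f a, f b) \<in> R1" using ab by (force simp: R1_def)
              then show ?thesis using n ab R0V by auto
            qed
            moreover have "(\<lambda>x\<in>V. c (f x)) u = (\<lambda>x\<in>V. c (f x)) v"
              using uV vV by (simp add: f_def)
            ultimately show "(\<lambda>x\<in>V. c (f x)) \<in> D"
              unfolding D_def C_def by blast
          qed
        qed
        have "card (C V R q) = card (C V R0 q) - card D"
          unfolding CD using DC finC finite_subset by (intro card_Diff_subset) auto
        moreover have "card D \<le> card (C V R0 q)" using DC finC by (rule card_mono[rotated])
        ultimately show ?thesis
          using bij_betw_same_card[OF bij] by (simp add: p0(3) p1(2) of_nat_diff)
      qed
      have deg: "degree (p0 - p1) \<le> card V"
        using p0(1) p1(1) cW by (intro degree_diff_le) auto
      have lead: "coeff (p0 - p1) (card V) = 1" if "irrefl R"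
      proof -
        have "irrefl R0" using that R by (auto simp: irrefl_def)
        moreover have "coeff p1 (card V) = 0" using p1(1) cW by (intro coeff_eq_0) simp
        ultimately show ?thesis using p0(2) by simp
      qed
      show ?thesis using deg lead count unfolding C_def by blast
    qed
  qed
qed

lemma is_chromatic_poly_ex1:
  assumes "finite_simple_graph V E"
  shows "\<exists>!P. is_chromatic_poly V E P"
proof (rule ex_ex1I)
  define R where "R = {(u, v). {u, v} \<in> E}"
  have V: "finite V" and RV: "R \<subseteq> V \<times> V"
    using assms by (auto simp: finite_simple_graph_def R_def)
  have irr: "irrefl R"
    using assms by (force simp: finite_simple_graph_def R_def irrefl_def)
  have "finite R" using RV V by (meson finite_SigmaI finite_subset)
  from colouring_count_poly[OF this V RV] obtain p :: "complex poly"
    where p: "degree p \<le> card V" "coeff p (card V) = 1"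
      "\<And>q. poly p (of_nat q) = of_nat (card {c \<in> V \<rightarrow>\<^sub>E {..<q}. \<forall>(u, v)\<in>R. c u \<noteq> c v})"
    using irr by blast
  have "degree p = card V"
    using p(1,2) le_degree[of p "card V"] by auto
  moreover have "{c \<in> V \<rightarrow>\<^sub>E {..<q}. \<forall>(u, v)\<in>R. c u \<noteq> c v} = proper_colourings V E q" for q
    by (auto simp: proper_colourings_def R_def)
  ultimately show "\<exists>P. is_chromatic_poly V E P"
    using p(2,3) by (intro exI[of _ p]) (simp add: is_chromatic_poly_def)
next
  fix P Q assume "is_chromatic_poly V E P" "is_chromatic_poly V E Q"
  then have "range of_nat \<subseteq> {x. poly (P - Q) x = 0}"
    by (auto simp: is_chromatic_poly_def)
  moreover have "infinite (range (of_nat :: nat \<Rightarrow> complex))"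
    by (intro range_inj_infinite inj_of_nat)
  ultimately have "infinite {x. poly (P - Q) x = 0}"
    using finite_subset by blast
  then have "P - Q = 0" using poly_roots_finite by blast
  then show "P = Q" by simp
qed

lemma is_chromatic_poly_chromatic_poly:
  "finite_simple_graph V E \<Longrightarrow> is_chromatic_poly V E (chromatic_poly V E)"
  unfolding chromatic_poly_def by (rule theI') (rule is_chromatic_poly_ex1)

end

(*
  Fix n and let w = 1 - q / n. Take a clique X on n vertices, a single vertex y, and p disjoint
  chains of t cliques on n vertices leading from y to X, consecutive cliques being completely
  joined. With s = t + 1, the number of colourings of a chain, given the colours of y and X, is
  proportional to w^s - w if the colour of y occurs in X and to w^s - 1 otherwise, so q is a
  chromatic root whenever (w^s - w)^p = w (w^s - 1)^p. This equation does not involve n, so all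
  positive integer multiples of 1 - w are chromatic roots as well. Adding a dominating vertex
  translates chromatic roots by 1, so that all multiples of 1 - w + r are chromatic roots for
  every natural r. For large s the function (w^s - w) / (w^s - 1) crosses the unit circle near any
  given point with |w| > 1, and by Hurwitz's theorem the equation then has solutions nearby for
  some p; translating by r reaches the rest of the plane.
*)

theory Submission
  imports Defs "HOL-Complex_Analysis.Great_Picard" "HOL-Real_Asymp.Real_Asymp"
begin

section \<open>List colourings\<close>

text \<open>Lists make conditioning possible: once some vertices are coloured, their colours are
  deleted from the lists of their neighbours, and what remains is again a list colouring
  problem.\<close>

definition list_colourings :: "('a \<Rightarrow> 'a \<Rightarrow> bool) \<Rightarrow> 'a set \<Rightarrow> ('a \<Rightarrow> 'b set) \<Rightarrow> ('a \<Rightarrow> 'b) set" where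
  "list_colourings adj V L = {c \<in> PiE V L. \<forall>u\<in>V. \<forall>v\<in>V. adj u v \<longrightarrow> c u \<noteq> c v}"

lemma finite_list_colourings:
  assumes "finite V" "\<And>u. u \<in> V \<Longrightarrow> finite (L u)"
  shows "finite (list_colourings adj V L)"
  using assms unfolding list_colourings_def
  by (intro finite_subset[OF _ finite_PiE[of V L]]) auto

lemma list_colourings_cong:
  assumes "V = W" "\<And>u. u \<in> W \<Longrightarrow> L u = M u"
  shows "list_colourings adj V L = list_colourings adj W M"
  using assms PiE_cong[of W L M] by (simp add: list_colourings_def)

text \<open>Colour \<open>V\<close> first. A colouring \<open>c\<close> of \<open>V\<close> extends
  by exactly those colourings of \<open>W\<close> in which every vertex avoids the colours that
  \<open>c\<close> gives to its neighbours in \<open>V\<close>, so restricting to \<open>V\<close>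
  and to \<open>W\<close> is a bijection onto a dependent sum.\<close>

lemma card_list_colourings_Un:
  assumes "finite V" "finite W" "V \<inter> W = {}" "symp adj" "\<And>u. u \<in> V \<union> W \<Longrightarrow> finite (L u)"
  shows "card (list_colourings adj (V \<union> W) L) =
    (\<Sum>c\<in>list_colourings adj V L. card (list_colourings adj W (\<lambda>u. L u - c ` {v\<in>V. adj u v})))"
proof -
  let ?M = "\<lambda>c u. L u - c ` {v\<in>V. adj u v}"
  let ?S = "SIGMA c:list_colourings adj V L. list_colourings adj W (?M c)"
  let ?f = "\<lambda>(c, d) x. if x \<in> V then c x else d x"
  have "bij_betw ?f ?S (list_colourings adj (V \<union> W) L)"
  proof (rule bij_betw_byWitness[where f' = "\<lambda>c. (restrict c V, restrict c W)"])
    show "\<forall>x\<in>?S. (restrict (?f x) V, restrict (?f x) W) = x"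
    proof
      fix x assume "x \<in> ?S"
      then obtain c d where x: "x = (c, d)" and c: "c \<in> list_colourings adj V L" and d: "d \<in> list_colourings adj W (?M c)"
        by auto
      then have "c \<in> extensional V" "d \<in> extensional W"
        by (auto simp: list_colourings_def PiE_def)
      then show "(restrict (?f x) V, restrict (?f x) W) = x"
        using assms(3) by (auto simp: x fun_eq_iff extensional_def)
    qed
    show "\<forall>c\<in>list_colourings adj (V \<union> W) L. ?f (restrict c V, restrict c W) = c"
      by (auto simp: list_colourings_def PiE_def extensional_def fun_eq_iff)
    show "?f ` ?S \<subseteq> list_colourings adj (V \<union> W) L"
    proof (rule image_subsetI)
      fix x assume "x \<in> ?S"
      then obtain c d where x: "x = (c, d)" and c: "c \<in> list_colourings adj V L"
        and d: "d \<in> list_colourings adj W (?M c)" by auto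
      have cP: "c \<in> PiE V L" and cn: "\<And>u v. u \<in> V \<Longrightarrow> v \<in> V \<Longrightarrow> adj u v \<Longrightarrow> c u \<noteq> c v"
        using c by (auto simp: list_colourings_def)
      have dP: "d \<in> PiE W (?M c)" and dn: "\<And>u v. u \<in> W \<Longrightarrow> v \<in> W \<Longrightarrow> adj u v \<Longrightarrow> d u \<noteq> d v"
        using d by (auto simp: list_colourings_def)
      have cross: "d u \<noteq> c v" if "u \<in> W" "v \<in> V" "adj u v" for u v
        using PiE_mem[OF dP that(1)] that by auto
      have "?f (c, d) \<in> PiE (V \<union> W) L"
        using cP dP by (auto simp: PiE_def Pi_def extensional_def)
      moreover have "?f (c, d) u \<noteq> ?f (c, d) v" if "u \<in> V \<union> W" "v \<in> V \<union> W" "adj u v" for u v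
        using that cn[of u v] dn[of u v] cross[of u v] cross[of v u] sympD[OF assms(4), of u v] by auto
      ultimately show "?f x \<in> list_colourings adj (V \<union> W) L"
        by (simp add: x list_colourings_def)
    qed
    show "(\<lambda>c. (restrict c V, restrict c W)) ` list_colourings adj (V \<union> W) L \<subseteq> ?S"
    proof clarify
      fix c assume "c \<in> list_colourings adj (V \<union> W) L"
      then have c: "c \<in> PiE (V \<union> W) L" and n: "\<And>u v. u \<in> V \<union> W \<Longrightarrow> v \<in> V \<union> W \<Longrightarrow> adj u v \<Longrightarrow> c u \<noteq> c v"
        by (auto simp: list_colourings_def)
      have "restrict c V \<in> list_colourings adj V L"
        using c n by (auto simp: list_colourings_def)
      moreover have "restrict c W \<in> list_colourings adj W (?M (restrict c V))"
        using c n by (auto simp: list_colourings_def)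
      ultimately show "restrict c V \<in> list_colourings adj V L \<and>
        restrict c W \<in> list_colourings adj W (?M (restrict c V))" by blast
    qed
  qed
  then have "card (list_colourings adj (V \<union> W) L) = card ?S"
    by (simp add: bij_betw_same_card)
  also have "\<dots> = (\<Sum>c\<in>list_colourings adj V L. card (list_colourings adj W (?M c)))"
    using assms by (intro card_SigmaI ballI finite_list_colourings) auto
  finally show ?thesis .
qed

lemma list_colourings_empty: "list_colourings adj {} L = {\<lambda>_. undefined}"
  by (auto simp: list_colourings_def)

lemma list_colourings_singleton:
  assumes "\<not> adj v v"
  shows "list_colourings adj {v} L = (\<lambda>a. \<lambda>x\<in>{v}. a) ` L v"
  using assms unfolding list_colourings_def 
  by (auto simp: PiE_def extensional_def fun_eq_iff image_iff restrict_def)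

lemma sum_list_colourings_singleton:
  assumes "\<not> adj v v"
  shows "(\<Sum>c\<in>list_colourings adj {v} L. f (c v)) = sum f (L v)"
proof -
  have "inj_on (\<lambda>a. \<lambda>x\<in>{v}. a) (L v)"
    by (auto simp: inj_on_def fun_eq_iff split: if_splits)
  then show ?thesis
    unfolding list_colourings_singleton[of adj v, OF assms] by (simp add: sum.reindex)
qed

lemma card_list_colourings_insert:
  assumes "finite V" "v \<notin> V" "symp adj" "\<not> adj v v" "\<And>u. u \<in> insert v V \<Longrightarrow> finite (L u)"
  shows "card (list_colourings adj (insert v V) L) =
    (\<Sum>a\<in>L v. card (list_colourings adj V (\<lambda>u. L u - (if adj u v then {a} else {}))))"
proof -
  have "card (list_colourings adj ({v} \<union> V) L) =
    (\<Sum>c\<in>list_colourings adj {v} L.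
      card (list_colourings adj V (\<lambda>u. L u - c ` {x\<in>{v}. adj u x})))"
    using assms by (intro card_list_colourings_Un) auto
  also have "\<dots> = (\<Sum>c\<in>list_colourings adj {v} L.
      card (list_colourings adj V (\<lambda>u. L u - (if adj u v then {c v} else {}))))"
    by (intro sum.cong refl arg_cong[where f = card] list_colourings_cong) auto
  also have "\<dots> = (\<Sum>a\<in>L v. card (list_colourings adj V (\<lambda>u. L u - (if adj u v then {a} else {}))))"
    by (rule sum_list_colourings_singleton[of adj v, OF assms(4)])
  finally show ?thesis by simp
qed

text \<open>Serves to separate the interiors of the \<open>p\<close> chains, which meet only through
  the end vertex and the final clique. Colouring one block leaves the lists of the others
  unchanged.\<close>

lemma card_list_colourings_UN:
  assumes "finite J" "\<And>j. j \<in> J \<Longrightarrow> finite (V j)" "disjoint_family_on V J" "symp adj"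
    and "\<And>j u. j \<in> J \<Longrightarrow> u \<in> V j \<Longrightarrow> finite (L u)"
    and "\<And>i j u v. i \<in> J \<Longrightarrow> j \<in> J \<Longrightarrow> i \<noteq> j \<Longrightarrow> u \<in> V i \<Longrightarrow> v \<in> V j \<Longrightarrow> \<not> adj u v"
  shows "card (list_colourings adj (\<Union>j\<in>J. V j) L) = (\<Prod>j\<in>J. card (list_colourings adj (V j) L))"
  using assms
proof (induction J rule: finite_induct)
  case empty
  then show ?case by (simp add: list_colourings_empty)
next
  case (insert j J)
  have "card (list_colourings adj (V j \<union> (\<Union>j\<in>J. V j)) L) =
    (\<Sum>c\<in>list_colourings adj (V j) L.
      card (list_colourings adj (\<Union>j\<in>J. V j) (\<lambda>u. L u - c ` {v\<in>V j. adj u v})))"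
    using insert.hyps insert.prems disjoint_family_on_disjoint_image
    by (intro card_list_colourings_Un) (auto simp: disjoint_family_on_def)
  also have "\<dots> = (\<Sum>c\<in>list_colourings adj (V j) L. card (list_colourings adj (\<Union>j\<in>J. V j) L))"
  proof (intro sum.cong refl arg_cong[where f = card] list_colourings_cong)
    fix c u assume "u \<in> (\<Union>j\<in>J. V j)"
    then have "{v\<in>V j. adj u v} = {}"
      using insert.hyps insert.prems(5) by blast
    then show "L u - c ` {v\<in>V j. adj u v} = L u" by (simp only: image_empty Diff_empty)
  qed
  also have "card (list_colourings adj (\<Union>j\<in>J. V j) L) = (\<Prod>j\<in>J. card (list_colourings adj (V j) L))"
    proof (rule insert.IH)
    show "disjoint_family_on V J"
      using insert.prems(2) by (rule disjoint_family_on_mono[rotated]) auto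
    show "\<not> adj u v" if "i \<in> J" "k \<in> J" "i \<noteq> k" "u \<in> V i" "v \<in> V k" for i k u v
      using insert.prems(5) that by blast
  qed (use insert.prems in auto)
  finally show ?case using insert.hyps by simp
qed

text \<open>Colourings of a clique are injections, hence the falling factorial. Subtracting in a
  ring rather than in \<nat> makes the count a polynomial in \<open>card A\<close>.\<close>

lemma card_list_colourings_clique:
  assumes "finite K" "\<And>u v. u \<in> K \<Longrightarrow> v \<in> K \<Longrightarrow> adj u v \<longleftrightarrow> u \<noteq> v" "finite A"
  shows "(of_nat (card (list_colourings adj K (\<lambda>_. A))) :: 'c :: comm_ring_1) =
    (\<Prod>i<card K. of_nat (card A) - of_nat i)"
proof -
  have "list_colourings adj K (\<lambda>_. A) = {c \<in> K \<rightarrow>\<^sub>E A. inj_on c K}"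
    using assms(2) by (auto simp: list_colourings_def inj_on_def)
  then have "card (list_colourings adj K (\<lambda>_. A)) = (\<Prod>i<card K. card A - i)"
    using card_inj_on_subset_funcset[OF assms(1,3) order.refl] by (simp add: lessThan_atLeast0)
  moreover have "(of_nat (\<Prod>i<card K. card A - i) :: 'c) = (\<Prod>i<card K. of_nat (card A) - of_nat i)"
  proof (cases "card K \<le> card A")
    case True
    then show ?thesis by (simp add: of_nat_diff)
  next
    \<comment> \<open>With too few colours both products contain a zero factor, at the index
      \<open>card A\<close>.\<close>
    case False
    then have "(\<Prod>i<card K. of_nat (card A) - of_nat i :: 'c) = 0" "(\<Prod>i<card K. card A - i) = 0"
      by (auto intro!: prod_zero bexI[of _ "card A"])
    then show ?thesis by (simp only: of_nat_0)
  qed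
  ultimately show ?thesis by simp
qed

section \<open>Chains of cliques\<close>

text \<open>The numbers of colourings of a chain of \<open>t\<close> cliques on \<open>n\<close> vertices between a vertex and an
  \<open>n\<close>-clique with given colours: the first component is for the case that the colour of the vertex
  occurs in the final clique, the second one for the case that it does not.\<close>

primrec chain_polys :: "nat \<Rightarrow> nat \<Rightarrow> complex poly \<times> complex poly" where
  "chain_polys n 0 = (0, 1)"
| "chain_polys n (Suc t) =
    (let (A, B) = chain_polys n t;
         F = (\<Prod>i<n. [:- of_nat (n + i), 1:]);
         F' = (\<Prod>i<n. [:- of_nat (Suc (n + i)), 1:])
     in (F * B, (F - F') * A + F' * B))"

text \<open>Only the size of the forbidden set \<open>T\<close> matters, so all sets of one size
  give values of the same polynomial at the number of colours.\<close>

lemma card_list_colourings_clique_Diff: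
  assumes "finite K" "\<And>u v. u \<in> K \<Longrightarrow> v \<in> K \<Longrightarrow> adj u v \<longleftrightarrow> u \<noteq> v" "finite A" "T \<subseteq> A"
  shows "(of_nat (card (list_colourings adj K (\<lambda>_. A - T))) :: 'c :: comm_ring_1) =
    poly (\<Prod>i<card K. [:- of_nat (card T + i), 1:]) (of_nat (card A))"
proof -
  have "finite T" using assms(3,4) finite_subset by blast
  then have "card (A - T) = card A - card T" "card T \<le> card A"
    using assms(3,4) by (auto simp: card_Diff_subset card_mono)
  moreover have "(of_nat (card (list_colourings adj K (\<lambda>_. A - T))) :: 'c) =
      (\<Prod>i<card K. of_nat (card (A - T)) - of_nat i)"
    using assms by (intro card_list_colourings_clique) auto
  ultimately show ?thesis by (simp add: poly_prod of_nat_diff algebra_simps)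
qed

text \<open>Induction on \<open>t\<close>, colouring the last clique \<open>K\<close> first. The
  colours of \<open>K\<close> become the set \<open>S\<close> of the shorter chain, so
  \<open>S\<close> must be arbitrary in the induction. The count depends on \<open>S\<close> only
  through whether \<open>a \<in> S\<close>, which is why two components suffice. The singleton list
  makes \<open>y\<close> a precoloured vertex.\<close>

lemma card_list_colourings_chain:
  assumes "symp adj" "B 0 = {y}" "finite Q" "a \<in> Q" "S \<subseteq> Q" "card S = n"
    and "\<And>i. 0 < i \<Longrightarrow> i \<le> t \<Longrightarrow> finite (B i) \<and> card (B i) = n"
    and "\<And>i j u v. i \<le> t \<Longrightarrow> j \<le> t \<Longrightarrow> u \<in> B i \<Longrightarrow> v \<in> B j \<Longrightarrow>
      adj u v \<longleftrightarrow> u \<noteq> v \<and> (i = j \<or> i = Suc j \<or> j = Suc i)"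
    and "disjoint_family_on B {..t}"
  shows "(of_nat (card (list_colourings adj (\<Union>i\<le>t. B i)
      (\<lambda>u. (if u = y then {a} else Q) - (if u \<in> B t then S else {})))) :: complex) =
    (if a \<in> S then poly (fst (chain_polys n t)) (of_nat (card Q))
     else poly (snd (chain_polys n t)) (of_nat (card Q)))"
  using assms(5-9)
proof (induction t arbitrary: S)
  case 0
  \<comment> \<open>Without cliques the last block is \<open>{y}\<close> itself: its list
    \<open>{a} - S\<close> is empty or a singleton, whence the initial pair
    \<open>(0, 1)\<close>.\<close>
  have "\<not> adj y y" using 0(4)[of 0 0 y y] assms(2) by simp
  then have "list_colourings adj {y} L = (\<lambda>a. \<lambda>x\<in>{y}. a) ` L y" for L :: "'a \<Rightarrow> 'b set"
    by (rule list_colourings_singleton)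
  then show ?case using assms(2) by (simp add: insert_Diff_if)
next
  case (Suc t)
  let ?q = "of_nat (card Q) :: complex"
  let ?L = "\<lambda>t S u. (if u = y then {a} else Q) - (if u \<in> B t then S else {})"
  let ?F = "\<Prod>i<n. [:- of_nat (n + i), 1 :: complex:]" and ?F' = "\<Prod>i<n. [:- of_nat (Suc (n + i)), 1 :: complex:]"
  let ?A = "poly (fst (chain_polys n t)) ?q" and ?B = "poly (snd (chain_polys n t)) ?q"
  define K where "K = B (Suc t)"
  have K: "finite K" "card K = n" using Suc.prems(3)[of "Suc t"] by (auto simp: K_def)
  have disj: "B i \<inter> B j = {}" if "i \<le> Suc t" "j \<le> Suc t" "i \<noteq> j" for i j
    using Suc.prems(5) that by (auto simp: disjoint_family_on_def)
  have yK: "y \<notin> K" using disj[of 0 "Suc t"] assms(2) by (auto simp: K_def)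
  have finB: "finite (B i)" if "i \<le> Suc t" for i
    using Suc.prems(3)[of i] assms(2) that by (cases "i = 0") auto
  have S: "finite S" using Suc.prems(1) assms(3) finite_subset by blast
  have adjK: "adj u v \<longleftrightarrow> u \<noteq> v" if "u \<in> K" "v \<in> K" for u v
    using Suc.prems(4)[of "Suc t" "Suc t" u v] that by (simp add: K_def)
  have adjB: "adj u v \<longleftrightarrow> i = t" if "u \<in> B i" "v \<in> K" "i \<le> t" for u v i
    using Suc.prems(4)[of i "Suc t" u v] disj[of i "Suc t"] that by (auto simp: K_def)
  define C where "C = list_colourings adj K (\<lambda>_. Q - S)"
  have finC: "finite C" unfolding C_def using K assms(3) by (intro finite_list_colourings) auto
  have C: "c ` K \<subseteq> Q - S" "card (c ` K) = n" if "c \<in> C" for c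
  proof -
    have "c \<in> K \<rightarrow> Q - S" "inj_on c K"
      using that adjK unfolding C_def list_colourings_def by (auto simp: inj_on_def)
    then show "c ` K \<subseteq> Q - S" "card (c ` K) = n"
      using K by (auto simp: card_image)
  qed
  have KB: "K \<inter> (\<Union>i\<le>t. B i) = {}"
  proof -
    have "B (Suc t) \<inter> B i = {}" if "i \<le> t" for i using disj[of "Suc t" i] that by simp
    then show ?thesis by (auto simp: K_def)
  qed
  have "(\<Union>i\<le>Suc t. B i) = K \<union> (\<Union>i\<le>t. B i)"
    by (auto simp: K_def atMost_Suc)
  then have "card (list_colourings adj (\<Union>i\<le>Suc t. B i) (?L (Suc t) S)) =
      (\<Sum>c\<in>list_colourings adj K (?L (Suc t) S). card (list_colourings adj (\<Union>i\<le>t. B i)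
        (\<lambda>u. ?L (Suc t) S u - c ` {v\<in>K. adj u v})))"
    using card_list_colourings_Un[of K "\<Union>i\<le>t. B i" adj "?L (Suc t) S"] K(1) finB KB assms(1,3) by simp
  also have "list_colourings adj K (?L (Suc t) S) = C"
    unfolding C_def using yK by (intro list_colourings_cong) (auto simp: K_def)
  also have "(\<Sum>c\<in>C. card (list_colourings adj (\<Union>i\<le>t. B i)
      (\<lambda>u. ?L (Suc t) S u - c ` {v\<in>K. adj u v}))) =
    (\<Sum>c\<in>C. card (list_colourings adj (\<Union>i\<le>t. B i) (?L t (c ` K))))"
  proof (intro sum.cong refl arg_cong[where f = card] list_colourings_cong)
    fix c u assume "u \<in> (\<Union>i\<le>t. B i)"
    then obtain i where i: "i \<le> t" "u \<in> B i" by auto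
    have "u \<notin> B (Suc t)" using disj[of i "Suc t"] i by auto
    moreover have "u \<in> B t \<longleftrightarrow> i = t" using disj[of i t] i by auto
    moreover have "{v\<in>K. adj u v} = (if i = t then K else {})" using adjB[of u i] i by auto
    ultimately show "?L (Suc t) S u - c ` {v\<in>K. adj u v} = ?L t (c ` K) u" by simp
  qed
  also have "of_nat \<dots> = (\<Sum>c\<in>C. if a \<in> c ` K then ?A else ?B)"
    unfolding of_nat_sum
  proof (rule sum.cong[OF refl])
    fix c assume c: "c \<in> C"
    have "disjoint_family_on B {..t}"
      using Suc.prems(5) by (rule disjoint_family_on_mono[rotated]) auto
    then show "of_nat (card (list_colourings adj (\<Union>i\<le>t. B i) (?L t (c ` K)))) =
        (if a \<in> c ` K then ?A else ?B)"
      using C[OF c] Suc.prems(3,4) by (intro Suc.IH) auto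
  qed
  \<comment> \<open>Every colouring of \<open>K\<close> contributes \<open>?A\<close>, and those
    that avoid \<open>a\<close> get the correction \<open>?B - ?A\<close>.\<close>
  also have "\<dots> = of_nat (card C) * ?A + of_nat (card {c\<in>C. a \<notin> c ` K}) * (?B - ?A)"
  proof -
    have "(\<Sum>c\<in>C. if a \<in> c ` K then ?A else ?B) = (\<Sum>c\<in>C. ?A + (if a \<notin> c ` K then ?B - ?A else 0))"
      by (intro sum.cong) auto
    then show ?thesis
      using finC by (simp add: sum.distrib sum.If_cases Int_def)
  qed
  also have "{c\<in>C. a \<notin> c ` K} = list_colourings adj K (\<lambda>_. Q - insert a S)"
    unfolding C_def list_colourings_def by (auto simp: PiE_def Pi_def)
  also have "(of_nat (card C) :: complex) = poly ?F ?q"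
    unfolding C_def
    using card_list_colourings_clique_Diff[where 'c = complex, OF K(1) adjK assms(3) Suc.prems(1)]
    by (simp only: K(2) Suc.prems(2))
  \<comment> \<open>Avoiding both \<open>a\<close> and \<open>S\<close> forbids \<open>n\<close>
    colours if \<open>a \<in> S\<close> and \<open>n + 1\<close> otherwise; these cases produce the
    factors \<open>F\<close> and \<open>F'\<close> of the recursion.\<close>
  also have "of_nat (card (list_colourings adj K (\<lambda>_. Q - insert a S))) = poly (if a \<in> S then ?F else ?F') ?q"
  proof -
    have I: "insert a S \<subseteq> Q" using assms(4) Suc.prems(1) by simp
    have ci: "card (insert a S) = (if a \<in> S then n else Suc n)"
      using S Suc.prems(2) by (auto simp: insert_absorb)
    show ?thesis
      using card_list_colourings_clique_Diff[where 'c = complex, OF K(1) adjK assms(3) I]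
      unfolding ci K(2) by (cases "a \<in> S") simp_all
  qed
  finally show ?case
    by (cases "a \<in> S") (simp_all add: split_beta Let_def left_diff_distrib right_diff_distrib
      del: of_nat_Suc of_nat_add poly_prod)
qed

section \<open>Thetas of cliques\<close>

text \<open>A vertex \<open>(i, j, l)\<close> is the \<open>l\<close>-th vertex of the \<open>i\<close>-th clique of the \<open>j\<close>-th chain; the
  levels \<open>0\<close> (a single vertex) and \<open>Suc t\<close> are shared by all chains and have \<open>j = 0\<close>.\<close>

definition theta_adj :: "nat \<Rightarrow> nat \<times> nat \<times> nat \<Rightarrow> nat \<times> nat \<times> nat \<Rightarrow> bool" where
  "theta_adj t = (\<lambda>(i, j, l) (i', j', l'). (i = i' \<and> j = j' \<and> l \<noteq> l') \<or>
    ((i = Suc i' \<or> i' = Suc i) \<and> (j = j' \<or> i \<in> {0, Suc t} \<or> i' \<in> {0, Suc t})))"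

definition theta_verts :: "nat \<Rightarrow> nat \<Rightarrow> nat \<Rightarrow> (nat \<times> nat \<times> nat) set" where
  "theta_verts n t p = {Suc t} \<times> {0} \<times> {..<n} \<union> insert (0, 0, 0) ({0<..t} \<times> {..<p} \<times> {..<n})"

text \<open>The product counts the colourings of the final clique. Given one of them,
  \<open>n\<close> colours of the start vertex occur in the clique and \<open>q - n\<close> do not,
  and each of the \<open>p\<close> chains contributes one factor.\<close>

definition theta_poly :: "nat \<Rightarrow> nat \<Rightarrow> nat \<Rightarrow> complex poly" where
  "theta_poly n t p = (\<Prod>i<n. [:- of_nat i, 1:]) *
    (smult (of_nat n) (fst (chain_polys n t) ^ p) + [:- of_nat n, 1:] * snd (chain_polys n t) ^ p)"

lemma symp_theta_adj: "symp (theta_adj t)"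
  by (auto simp: symp_def theta_adj_def)

lemma theta_adj_irrefl: "\<not> theta_adj t v v"
  by (auto simp: theta_adj_def)

lemma finite_theta_verts: "finite (theta_verts n t p)"
  by (simp add: theta_verts_def)

text \<open>Colour the final clique \<open>X\<close>, then the vertex \<open>y\<close>, then the
  chain interiors \<open>I j\<close>, which are independent by then.\<close>

lemma card_list_colourings_theta:
  assumes "finite Q" "0 < t"
  shows "of_nat (card (list_colourings (theta_adj t) (theta_verts n t p) (\<lambda>_. Q))) =
    poly (theta_poly n t p) (of_nat (card Q))"
proof -
  let ?q = "of_nat (card Q) :: complex"
  let ?A = "poly (fst (chain_polys n t)) ?q" and ?B = "poly (snd (chain_polys n t)) ?q"
  define y where "y = (0 :: nat, 0 :: nat, 0 :: nat)"
  define X where "X = {Suc t} \<times> {0 :: nat} \<times> {..<n}"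
  define I where "I j = {0<..t} \<times> {j} \<times> {..<n}" for j :: nat
  define B where "B j i = (if i = 0 then {y} else {i} \<times> {j} \<times> {..<n})" for j i :: nat
  define W where "W = (\<Union>j<p. I j)"
  have V: "theta_verts n t p = X \<union> insert y W"
    by (auto simp: theta_verts_def X_def W_def I_def y_def)
  have fin: "finite X" "finite W" "finite (I j)" "finite (B j i)" for i j
    by (simp_all add: X_def W_def I_def B_def)
  have cX: "card X = n" by (simp add: X_def)
  have yW: "y \<notin> W" "y \<notin> I j" for j by (auto simp: y_def W_def I_def)
  have adjX: "theta_adj t u v \<longleftrightarrow> u \<noteq> v" if "u \<in> X" "v \<in> X" for u v
    using that by (auto simp: X_def theta_adj_def)
  \<comment> \<open>Here \<open>0 < t\<close> enters: with a level between them, \<open>X\<close>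
    puts no restriction on the colour of \<open>y\<close>.\<close>
  have yX: "\<not> theta_adj t y v" if "v \<in> X" for v
    using that assms(2) by (auto simp: X_def theta_adj_def y_def)
  have IX: "{v \<in> X. theta_adj t u v} = (if u \<in> B j t then X else {})" if "u \<in> I j" for u j
    using that assms(2) by (auto simp: I_def B_def X_def theta_adj_def)
  have BI: "(\<Union>i\<le>t. B j i) = insert y (I j)" for j
  proof -
    have "{..t} = insert 0 {0<..t}" by auto
    moreover have "(\<Union>i\<in>{0<..t}. B j i) = I j" by (auto simp: B_def I_def)
    ultimately have "(\<Union>i\<le>t. B j i) = B j 0 \<union> I j" by (simp only: UN_insert)
    then show ?thesis by (simp add: B_def)
  qed
  have chain: "(of_nat (card (list_colourings (theta_adj t) (I j)
      (\<lambda>u. Q - c ` {v \<in> X. theta_adj t u v} - (if theta_adj t u y then {a} else {})))) :: complex) =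
    (if a \<in> c ` X then ?A else ?B)"
    if c: "c ` X \<subseteq> Q" "card (c ` X) = n" and a: "a \<in> Q" for c a and j :: nat
  proof -
    let ?L = "\<lambda>u. (if u = y then {a} else Q) - (if u \<in> B j t then c ` X else {})"
    have yB: "y \<notin> B j t" using assms(2) by (auto simp: B_def y_def)
    have "(if a \<in> c ` X then ?A else ?B) = of_nat (card (list_colourings (theta_adj t) (\<Union>i\<le>t. B j i) ?L))"
    proof (rule card_list_colourings_chain[symmetric])
      show "theta_adj t u v \<longleftrightarrow> u \<noteq> v \<and> (i = k \<or> i = Suc k \<or> k = Suc i)"
        if "i \<le> t" "k \<le> t" "u \<in> B j i" "v \<in> B j k" for i k u v
        using that by (auto simp: B_def theta_adj_def y_def split: if_splits)
      show "disjoint_family_on (B j) {..t}"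
        by (auto simp: disjoint_family_on_def B_def y_def split: if_splits)
    qed (use c a assms fin symp_theta_adj in \<open>auto simp: B_def\<close>)
    \<comment> \<open>The chain lemma counts colourings that include \<open>y\<close>. Splitting off
      \<open>y\<close>, whose list is \<open>{a}\<close>, leaves a one-term sum over the interior
      \<open>I j\<close>.\<close>
    also have "card (list_colourings (theta_adj t) (\<Union>i\<le>t. B j i) ?L) =
        (\<Sum>b\<in>?L y. card (list_colourings (theta_adj t) (I j) (\<lambda>u. ?L u - (if theta_adj t u y then {b} else {}))))"
      unfolding BI using yW fin assms(1)
      by (intro card_list_colourings_insert symp_theta_adj theta_adj_irrefl) auto
    also have "?L y = {a}" using yB by simp
    also have "(\<Sum>b\<in>{a}. card (list_colourings (theta_adj t) (I j) (\<lambda>u. ?L u - (if theta_adj t u y then {b} else {})))) =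
      card (list_colourings (theta_adj t) (I j)
      (\<lambda>u. Q - c ` {v \<in> X. theta_adj t u v} - (if theta_adj t u y then {a} else {})))"
    proof (simp only: sum.insert sum.empty finite.emptyI empty_iff not_False_eq_True add_0_right,
        intro arg_cong[where f = card] list_colourings_cong refl)
      fix u assume u: "u \<in> I j"
      then have "u \<noteq> y" using yW by auto
      then show "?L u - (if theta_adj t u y then {a} else {}) =
          Q - c ` {v \<in> X. theta_adj t u v} - (if theta_adj t u y then {a} else {})"
        unfolding IX[OF u] by simp
    qed
    finally show ?thesis by simp
  qed
  have inner: "of_nat (card (list_colourings (theta_adj t) (insert y W) (\<lambda>u. Q - c ` {v \<in> X. theta_adj t u v}))) =
      of_nat n * ?A ^ p + (?q - of_nat n) * ?B ^ p"
    if c: "c \<in> list_colourings (theta_adj t) X (\<lambda>_. Q)" for c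
  proof -
    have "c \<in> X \<rightarrow> Q" "inj_on c X"
      using c adjX unfolding list_colourings_def by (auto simp: inj_on_def)
    then have S: "c ` X \<subseteq> Q" "card (c ` X) = n" by (auto simp: card_image cX)
    let ?M = "\<lambda>a u. Q - c ` {v \<in> X. theta_adj t u v} - (if theta_adj t u y then {a} else {})"
    have "card (list_colourings (theta_adj t) (insert y W) (\<lambda>u. Q - c ` {v \<in> X. theta_adj t u v})) =
        (\<Sum>a\<in>Q - c ` {v \<in> X. theta_adj t y v}. card (list_colourings (theta_adj t) W (?M a)))"
      using yW fin assms(1) by (intro card_list_colourings_insert symp_theta_adj theta_adj_irrefl) auto
    also have "Q - c ` {v \<in> X. theta_adj t y v} = Q" using yX by auto
    also have "(\<Sum>a\<in>Q. card (list_colourings (theta_adj t) W (?M a))) =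
        (\<Sum>a\<in>Q. \<Prod>j<p. card (list_colourings (theta_adj t) (I j) (?M a)))"
      unfolding W_def
    proof (intro sum.cong refl card_list_colourings_UN symp_theta_adj)
      show "disjoint_family_on I {..<p}"
        by (auto simp: disjoint_family_on_def I_def)
      show "\<not> theta_adj t u v" if "i \<noteq> j" "u \<in> I i" "v \<in> I j" for i j u v
        using that by (auto simp: I_def theta_adj_def)
    qed (use fin assms(1) in auto)
    also have "of_nat \<dots> = (\<Sum>a\<in>Q. (if a \<in> c ` X then ?A else ?B) ^ p)"
      by (simp add: chain[OF S] del: if_image_distrib)
    also have "\<dots> = (\<Sum>a\<in>c ` X. ?A ^ p) + (\<Sum>a\<in>Q - c ` X. ?B ^ p)"
      using S(1) assms(1)
      by (subst sum.subset_diff[OF S(1) assms(1)]) (simp add: add.commute)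
    also have "\<dots> = of_nat n * ?A ^ p + (?q - of_nat n) * ?B ^ p"
      using S assms(1) card_mono[OF assms(1) S(1)] fin(1)
      by (simp add: card_Diff_subset of_nat_diff)
    finally show ?thesis .
  qed
  have "card (list_colourings (theta_adj t) (X \<union> insert y W) (\<lambda>_. Q)) =
    (\<Sum>c\<in>list_colourings (theta_adj t) X (\<lambda>_. Q).
      card (list_colourings (theta_adj t) (insert y W) (\<lambda>u. Q - c ` {v \<in> X. theta_adj t u v})))"
    using fin assms(1)
    by (intro card_list_colourings_Un symp_theta_adj) (auto simp: X_def W_def I_def y_def)
  also have "of_nat \<dots> = of_nat (card (list_colourings (theta_adj t) X (\<lambda>_. Q))) *
      (of_nat n * ?A ^ p + (?q - of_nat n) * ?B ^ p)"
    by (simp add: inner)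
  also have "of_nat (card (list_colourings (theta_adj t) X (\<lambda>_. Q))) = poly (\<Prod>i<n. [:- of_nat i, 1:]) ?q"
    using card_list_colourings_clique_Diff[where 'c = complex, OF fin(1) adjX assms(1) empty_subsetI]
    by (simp add: cX)
  finally show ?thesis
    unfolding V theta_poly_def by (simp add: algebra_simps poly_power del: poly_prod)
qed

section \<open>Values of the chain and theta polynomials at \<open>n (1 - w)\<close>\<close>

text \<open>At \<open>z = n (1 - w)\<close> the products \<open>F\<close> and \<open>F'\<close>
  share \<open>n - 1\<close> factors, with product \<open>c\<close>; the remaining ones are
  \<open>z - n = - n w\<close> and \<open>z - 2 n = - n (1 + w)\<close>. Up to the scalar
  \<open>- n c\<close> the recursion thus maps \<open>(A, B)\<close> to
  \<open>(w B, (1 + w) B - A)\<close>, and this takes the pair \<open>(w ^ s - w, w ^ s - 1)\<close>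
  to the one for \<open>s + 1\<close>.\<close>

lemma poly_chain_polys:
  fixes w :: complex
  assumes "w \<noteq> 1" "0 < n"
  shows "\<exists>k. poly (fst (chain_polys n t)) (of_nat n * (1 - w)) = k * (w ^ Suc t - w) \<and>
    poly (snd (chain_polys n t)) (of_nat n * (1 - w)) = k * (w ^ Suc t - 1)"
proof (induction t)
  case 0
  \<comment> \<open>The initial pair \<open>(0, 1)\<close> is the pair for \<open>s = 1\<close>
    divided by \<open>w - 1\<close>.\<close>
  show ?case using assms(1) by (intro exI[of _ "1 / (w - 1)"]) simp
next
  case (Suc t)
  let ?z = "of_nat n * (1 - w)"
  obtain k where k: "poly (fst (chain_polys n t)) ?z = k * (w ^ Suc t - w)"
      "poly (snd (chain_polys n t)) ?z = k * (w ^ Suc t - 1)" using Suc by blast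
  obtain m where m: "n = Suc m" using assms(2) gr0_implies_Suc by blast
  define c where "c = (\<Prod>i<m. ?z - of_nat (Suc (n + i)))"
  have F: "poly (\<Prod>i<n. [:- of_nat (n + i), 1:]) ?z = - of_nat n * w * c"
  proof -
    have "poly (\<Prod>i<n. [:- of_nat (n + i), 1:]) ?z = (\<Prod>i<Suc m. ?z - of_nat (n + i))"
      unfolding m[symmetric] by (simp add: poly_prod algebra_simps)
    also have "\<dots> = (?z - of_nat n) * c"
      unfolding prod.lessThan_Suc_shift c_def by simp
    finally show ?thesis by (simp add: algebra_simps)
  qed
  have F': "poly (\<Prod>i<n. [:- of_nat (Suc (n + i)), 1:]) ?z = - of_nat n * (1 + w) * c"
  proof -
    have "poly (\<Prod>i<n. [:- of_nat (Suc (n + i)), 1:]) ?z = (\<Prod>i<Suc m. ?z - of_nat (Suc (n + i)))"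
      unfolding m[symmetric] by (simp add: poly_prod algebra_simps)
    also have "\<dots> = c * (?z - of_nat (Suc (n + m)))"
      unfolding prod.lessThan_Suc c_def by simp
    also have "of_nat (Suc (n + m)) = (2 * of_nat n :: complex)" by (simp add: m)
    finally show ?thesis by (simp add: algebra_simps)
  qed
  have fst: "poly (fst (chain_polys n (Suc t))) ?z = - of_nat n * w * c * (k * (w ^ Suc t - 1))"
    unfolding k(2)[symmetric] F[symmetric] by (simp add: split_beta Let_def del: of_nat_Suc of_nat_add)
  have snd: "poly (snd (chain_polys n (Suc t))) ?z =
      (- of_nat n * w * c - - of_nat n * (1 + w) * c) * (k * (w ^ Suc t - w)) +
      - of_nat n * (1 + w) * c * (k * (w ^ Suc t - 1))"
    unfolding k[symmetric] F[symmetric] F'[symmetric]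
    by (simp add: split_beta Let_def del: of_nat_Suc of_nat_add)
  show ?case
    unfolding fst snd by (intro exI[of _ "- of_nat n * c * k"]) (simp add: algebra_simps)
qed

text \<open>Since \<open>z - n = - n w\<close> at \<open>z = n (1 - w)\<close>, the second factor of
  \<open>theta_poly\<close> is \<open>n k ^ p\<close> times the difference of the two sides of the
  equation. The equation does not contain \<open>n\<close>, so one solution \<open>w\<close> serves
  every positive \<open>n\<close>.\<close>

lemma poly_theta_poly_eq_0:
  fixes w :: complex
  assumes "w \<noteq> 1" "0 < n" "(w ^ Suc t - w) ^ p = w * (w ^ Suc t - 1) ^ p"
  shows "poly (theta_poly n t p) (of_nat n * (1 - w)) = 0"
proof -
  obtain k where k: "poly (fst (chain_polys n t)) (of_nat n * (1 - w)) = k * (w ^ Suc t - w)"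
      "poly (snd (chain_polys n t)) (of_nat n * (1 - w)) = k * (w ^ Suc t - 1)"
    using poly_chain_polys[OF assms(1,2)] by blast
  have "of_nat n * (k * (w ^ Suc t - w)) ^ p + (of_nat n * (1 - w) - of_nat n) * (k * (w ^ Suc t - 1)) ^ p =
      of_nat n * k ^ p * ((w ^ Suc t - w) ^ p - w * (w ^ Suc t - 1) ^ p)"
    unfolding power_mult_distrib by (simp add: algebra_simps del: power_Suc)
  also have "\<dots> = 0" by (simp add: assms(3) del: power_Suc)
  finally show ?thesis
    unfolding theta_poly_def by (simp add: k left_diff_distrib del: power_Suc)
qed

section \<open>Chromatic roots\<close>

text \<open>The graph is copied to natural-number vertices along an injection \<open>f\<close>. Then
  \<open>P\<close> agrees with the chromatic polynomial at all natural numbers, so the two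
  coincide.\<close>

lemma chromatic_rootI:
  fixes V :: "'a set"
  assumes "finite V" "symp adj" "\<And>v. \<not> adj v v"
    and P: "\<And>q. of_nat (card (list_colourings adj V (\<lambda>_. {..<q :: nat}))) = poly P (of_nat q)"
    and "poly P z = 0"
  shows "chromatic_root z"
proof -
  obtain f :: "'a \<Rightarrow> nat" where f: "inj_on f V"
    using finite_imp_inj_to_nat_seg[OF assms(1)] by blast
  define E where "E = {{f u, f v} | u v. u \<in> V \<and> v \<in> V \<and> adj u v}"
  have G: "finite_simple_graph (f ` V) E"
  proof -
    have "f u \<noteq> f v" if "u \<in> V" "v \<in> V" "adj u v" for u v
      using that f assms(3) by (metis inj_onD)
    then show ?thesis
      using assms(1) unfolding finite_simple_graph_def E_def by auto
  qed
  have E: "{f u, f v} \<in> E \<longleftrightarrow> adj u v" if "u \<in> V" "v \<in> V" for u v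
    using that f sympD[OF assms(2)] unfolding E_def by (auto simp: doubleton_eq_iff inj_on_eq_iff)
  have EV: "a \<in> f ` V \<and> b \<in> f ` V" if "{a, b} \<in> E" for a b
    using that unfolding E_def by (auto simp: doubleton_eq_iff)
  let ?g = "the_inv_into V f"
  have g: "?g (f v) = v" if "v \<in> V" for v using the_inv_into_f_f[OF f that] .
  have count: "card (proper_colourings (f ` V) E q) = card (list_colourings adj V (\<lambda>_. {..<q}))" for q
  proof (rule bij_betw_same_card[OF bij_betw_byWitness[where f = "\<lambda>c. \<lambda>v\<in>V. c (f v)"
        and f' = "\<lambda>c. \<lambda>x\<in>f ` V. c (?g x)"]])
    show "\<forall>c\<in>proper_colourings (f ` V) E q. (\<lambda>x\<in>f ` V. (\<lambda>v\<in>V. c (f v)) (?g x)) = c"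
      by (auto simp: proper_colourings_def fun_eq_iff g PiE_def extensional_def)
    show "\<forall>c\<in>list_colourings adj V (\<lambda>_. {..<q}). (\<lambda>v\<in>V. (\<lambda>x\<in>f ` V. c (?g x)) (f v)) = c"
      by (auto simp: list_colourings_def fun_eq_iff g PiE_def extensional_def)
    show "(\<lambda>c. \<lambda>v\<in>V. c (f v)) ` proper_colourings (f ` V) E q \<subseteq> list_colourings adj V (\<lambda>_. {..<q})"
      using E by (auto simp: proper_colourings_def list_colourings_def)
    show "(\<lambda>c. \<lambda>x\<in>f ` V. c (?g x)) ` list_colourings adj V (\<lambda>_. {..<q}) \<subseteq> proper_colourings (f ` V) E q"
    proof (rule image_subsetI)
      fix c assume c: "c \<in> list_colourings adj V (\<lambda>_. {..<q})"
      let ?c = "\<lambda>x\<in>f ` V. c (?g x)"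
      have "?c a \<noteq> ?c b" if "{a, b} \<in> E" for a b
        using EV[OF that] E that c g by (auto simp: list_colourings_def)
      moreover have "?c \<in> f ` V \<rightarrow>\<^sub>E {..<q}"
        using c by (auto simp: list_colourings_def g)
      ultimately show "?c \<in> proper_colourings (f ` V) E q"
        unfolding proper_colourings_def by blast
    qed
  qed
  let ?R = "chromatic_poly (f ` V) E"
  have "range of_nat \<subseteq> {x. poly (?R - P) x = 0}"
    using is_chromatic_poly_chromatic_poly[OF G] count P by (auto simp: is_chromatic_poly_def)
  moreover have "infinite (range (of_nat :: nat \<Rightarrow> complex))"
    by (intro range_inj_infinite inj_of_nat)
  ultimately have "infinite {x. poly (?R - P) x = 0}"
    using finite_subset by blast
  then have "?R - P = 0" using poly_roots_finite by blast
  then show ?thesis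
    using G assms(5) unfolding chromatic_root_def by auto
qed

section \<open>Translation of chromatic roots by a dominating vertex\<close>

text \<open>Renaming colours. This is needed because deleting the colour of a dominating vertex
  leaves a list that need not be an initial segment of \<nat>.\<close>

lemma card_list_colourings_const:
  assumes "finite A"
  shows "card (list_colourings adj V (\<lambda>_. A)) = card (list_colourings adj V (\<lambda>_. {..<card A}))"
proof -
  obtain h where h: "bij_betw h A {..<card A}"
    using assms ex_bij_betw_finite_nat[of A] by (auto simp: lessThan_atLeast0)
  let ?g = "the_inv_into A h"
  have g: "?g (h a) = a" "h a < card A" if "a \<in> A" for a
    using h that by (auto simp: bij_betw_def the_inv_into_f_f)
  have g': "?g i \<in> A" "h (?g i) = i" if "i < card A" for i
    using h that f_the_inv_into_f_bij_betw[OF h] bij_betwE[OF bij_betw_the_inv_into[OF h]] by auto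
  show ?thesis
  proof (rule bij_betw_same_card[OF bij_betw_byWitness[where f = "\<lambda>c. \<lambda>v\<in>V. h (c v)"
        and f' = "\<lambda>c. \<lambda>v\<in>V. ?g (c v)"]])
    show "\<forall>c\<in>list_colourings adj V (\<lambda>_. A). (\<lambda>v\<in>V. ?g ((\<lambda>v\<in>V. h (c v)) v)) = c"
      by (auto simp: list_colourings_def fun_eq_iff g PiE_def extensional_def Pi_def)
    show "\<forall>c\<in>list_colourings adj V (\<lambda>_. {..<card A}). (\<lambda>v\<in>V. h ((\<lambda>v\<in>V. ?g (c v)) v)) = c"
      by (auto simp: list_colourings_def fun_eq_iff g' PiE_def extensional_def Pi_def)
    show "(\<lambda>c. \<lambda>v\<in>V. h (c v)) ` list_colourings adj V (\<lambda>_. A) \<subseteq> list_colourings adj V (\<lambda>_. {..<card A})"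
    proof (rule image_subsetI)
      fix c assume c: "c \<in> list_colourings adj V (\<lambda>_. A)"
      then have "c v \<in> A" if "v \<in> V" for v using that by (auto simp: list_colourings_def)
      moreover have "c u \<noteq> c v" if "u \<in> V" "v \<in> V" "adj u v" for u v
        using c that by (auto simp: list_colourings_def)
      ultimately show "(\<lambda>v\<in>V. h (c v)) \<in> list_colourings adj V (\<lambda>_. {..<card A})"
        using g by (simp add: list_colourings_def) metis
    qed
    show "(\<lambda>c. \<lambda>v\<in>V. ?g (c v)) ` list_colourings adj V (\<lambda>_. {..<card A}) \<subseteq> list_colourings adj V (\<lambda>_. A)"
    proof (rule image_subsetI)
      fix c assume c: "c \<in> list_colourings adj V (\<lambda>_. {..<card A})"
      then have "c v < card A" if "v \<in> V" for v using that by (auto simp: list_colourings_def)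
      moreover have "c u \<noteq> c v" if "u \<in> V" "v \<in> V" "adj u v" for u v
        using c that by (auto simp: list_colourings_def)
      ultimately show "(\<lambda>v\<in>V. ?g (c v)) \<in> list_colourings adj V (\<lambda>_. A)"
        using g' by (simp add: list_colourings_def) metis
    qed
  qed
qed

text \<open>A new vertex \<open>x\<close> joined to all of \<open>V\<close> takes one of
  \<open>q\<close> colours and leaves \<open>q - 1\<close> to the old graph, so the new chromatic
  polynomial is \<open>X P(X - 1)\<close>.\<close>

lemma chromatic_root_add_1:
  assumes "chromatic_root z"
  shows "chromatic_root (z + 1)"
proof -
  obtain V :: "nat set" and E where G: "finite_simple_graph V E" and z: "poly (chromatic_poly V E) z = 0"
    using assms by (auto simp: chromatic_root_def)
  have V: "finite V" and EV: "\<And>e. e \<in> E \<Longrightarrow> e \<subseteq> V \<and> card e = 2"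
    using G by (auto simp: finite_simple_graph_def)
  obtain x where x: "x \<notin> V" using V ex_new_if_finite[OF infinite_UNIV_nat] by blast
  define adj where "adj u v \<longleftrightarrow> {u, v} \<in> E \<or> (u = x) \<noteq> (v = x)" for u v
  have sym: "symp adj" by (auto simp: symp_def adj_def insert_commute)
  have irr: "\<not> adj v v" for v using EV[of "{v}"] by (auto simp: adj_def)
  have pc: "list_colourings adj V (\<lambda>_. {..<q}) = proper_colourings V E q" for q
    using x EV unfolding list_colourings_def proper_colourings_def adj_def by fastforce
  let ?P = "chromatic_poly V E"
  have count: "of_nat (card (list_colourings adj (insert x V) (\<lambda>_. {..<q}))) =
      poly ([:0, 1:] * pcompose ?P [:-1, 1:]) (of_nat q)" for q
  proof -
    have "card (list_colourings adj (insert x V) (\<lambda>_. {..<q})) =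
        (\<Sum>a<q. card (list_colourings adj V (\<lambda>u. {..<q} - (if adj u x then {a} else {}))))"
      using V x sym irr by (intro card_list_colourings_insert) auto
    also have "\<dots> = (\<Sum>a<q. card (list_colourings adj V (\<lambda>_. {..<q} - {a})))"
      using x by (intro sum.cong refl arg_cong[where f = card] list_colourings_cong) (auto simp: adj_def)
    also have "\<dots> = (\<Sum>a<q. card (proper_colourings V E (q - 1)))"
      by (intro sum.cong refl) (subst card_list_colourings_const, auto simp: pc)
    \<comment> \<open>For \<open>q = 0\<close> the truncated \<open>q - 1\<close> does no harm: the
      sum is empty and the factor \<open>X\<close> vanishes.\<close>
    finally show ?thesis
      using is_chromatic_poly_chromatic_poly[OF G]
      by (cases q) (simp_all add: is_chromatic_poly_def poly_pcompose distrib_right)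
  qed
  show ?thesis
    by (rule chromatic_rootI[OF _ sym irr count]) (use V z in \<open>auto simp: poly_pcompose\<close>)
qed

section \<open>Density\<close>

lemma norm_cis_diff_le: "cmod (cis a - cis b) \<le> \<bar>a - b\<bar>"
proof -
  have "cis a - cis b = cis b * (cis (a - b) - 1)"
    by (simp add: algebra_simps cis_mult)
  then have "cmod (cis a - cis b) = cmod (exp (\<i> * of_real (a - b)) - 1)"
    by (simp add: norm_mult cis_conv_exp)
  also have "\<dots> = 2 * \<bar>sin ((a - b) / 2)\<bar>" by (rule dist_exp_i_1)
  also have "\<dots> \<le> 2 * \<bar>(a - b) / 2\<bar>" by (intro mult_left_mono abs_sin_x_le_abs_x) auto
  finally show ?thesis by simp
qed

text \<open>The \<open>s\<close>-th roots of \<open>cmod w ^ s * v\<close> are spaced by the angle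
  \<open>2 pi / s\<close> on the circle through \<open>w\<close>, so one of them lies within that
  angle of \<open>w\<close>.\<close>

lemma exists_nearby_power_eq:
  fixes w v :: complex
  assumes "cmod v = 1" "s > 0"
  shows "\<exists>z. cmod z = cmod w \<and> cmod (z - w) \<le> cmod w * (2 * pi / real s) \<and> z ^ s = of_real (cmod w ^ s) * v"
proof -
  \<comment> \<open>Rounding down picks a root whose angle \<open>a\<close> satisfies
    \<open>a \<le> Arg w \<le> a + 2 pi / s\<close>.\<close>
  define k where "k = \<lfloor>(real s * Arg w - Arg v) / (2 * pi)\<rfloor>"
  define a where "a = (Arg v + 2 * pi * of_int k) / real s"
  have k: "real_of_int k \<le> (real s * Arg w - Arg v) / (2 * pi)"
      "(real s * Arg w - Arg v) / (2 * pi) \<le> real_of_int k + 1"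
    unfolding k_def by linarith+
  have d: "\<bar>a - Arg w\<bar> \<le> 2 * pi / real s"
  proof -
    have "real s * (Arg w - a) = real s * Arg w - Arg v - 2 * pi * of_int k"
      using assms(2) by (simp add: a_def field_simps)
    moreover have "2 * pi * of_int k \<le> real s * Arg w - Arg v"
        "real s * Arg w - Arg v \<le> 2 * pi * of_int k + 2 * pi"
      using k by (simp_all add: field_simps)
    ultimately have "0 \<le> real s * (Arg w - a)" "real s * (Arg w - a) \<le> 2 * pi" by linarith+
    then have "0 \<le> Arg w - a" "Arg w - a \<le> 2 * pi / real s"
      using assms(2) by (simp_all add: zero_le_mult_iff field_simps)
    then show ?thesis by linarith
  qed
  have v: "cis (Arg v) = v"
    using assms(1) cis_Arg[of v] by (cases "v = 0") (auto simp: sgn_div_norm)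
  have "cis a ^ s = cis (Arg v) * cis (2 * pi * of_int k)"
    unfolding Complex.DeMoivre cis_mult a_def using assms(2) by simp
  then have p: "cis a ^ s = v" using v by simp
  have "of_real (cmod w) * cis a - w = of_real (cmod w) * (cis a - cis (Arg w))"
    using rcis_cmod_Arg[of w] by (simp add: rcis_def algebra_simps)
  then have "cmod (of_real (cmod w) * cis a - w) = cmod w * cmod (cis a - cis (Arg w))"
    by (simp add: norm_mult)
  also have "\<dots> \<le> cmod w * (2 * pi / real s)"
    using norm_cis_diff_le[of a "Arg w"] d by (intro mult_left_mono) auto
  finally show ?thesis
    using p by (intro exI[of _ "of_real (cmod w) * cis a"]) (simp add: norm_mult power_mult_distrib)
qed

lemma uniform_limit_const_fun:
  "(f \<longlongrightarrow> l) F \<Longrightarrow> uniform_limit S (\<lambda>n _. f n) (\<lambda>_. l) F"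
  by (auto simp: uniform_limit_iff tendsto_iff elim: eventually_mono)

text \<open>On the convex set \<open>S\<close> there are logarithms \<open>H\<close> of
  \<open>h\<close> and \<open>G\<close> of \<open>g\<close>, and \<open>h z ^ p = g z\<close> says
  that \<open>p H z - G z\<close> is an integer multiple of \<open>2 pi i\<close>. As
  \<open>Re H\<close> changes sign, \<open>H\<close> is nonconstant and purely imaginary at some
  \<open>c\<close>. Dividing by \<open>p\<close> and choosing the integer suitably gives functions
  that tend to \<open>H - H c\<close>, which vanishes at \<open>c\<close>; by Hurwitz they cannot
  all be zero-free.\<close>

lemma exists_power_eq_of_crosses_unit_circle:
  assumes S: "open S" "convex S" and h: "h holomorphic_on S" "\<And>z. z \<in> S \<Longrightarrow> h z \<noteq> 0"
    and g: "g holomorphic_on S" "\<And>z. z \<in> S \<Longrightarrow> g z \<noteq> 0"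
    and a: "a \<in> S" "cmod (h a) < 1" and b: "b \<in> S" "1 < cmod (h b)"
  shows "\<exists>p>0. \<exists>z\<in>S. h z ^ p = g z"
proof (rule ccontr)
  assume no: "\<not> ?thesis"
  obtain H where H: "H holomorphic_on S" "\<And>z. z \<in> S \<Longrightarrow> exp (H z) = h z"
    using holomorphic_logarithm_exists[OF S(2,1) h a(1)] by blast
  obtain G where G: "G holomorphic_on S" "\<And>z. z \<in> S \<Longrightarrow> exp (G z) = g z"
    using holomorphic_logarithm_exists[OF S(2,1) g a(1)] by blast
  have nh: "cmod (h z) = exp (Re (H z))" if "z \<in> S" for z
    using H(2)[OF that] by (metis norm_exp_eq_Re)
  have ReH: "Re (H a) < 0" "0 < Re (H b)"
    using a b nh by auto
  have conn: "connected S" using S(2) by (rule convex_connected)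
  have "connected ((\<lambda>z. Re (H z)) ` S)"
    using holomorphic_on_imp_continuous_on[OF H(1)] conn
    by (intro connected_continuous_image continuous_intros)
  then have "0 \<in> (\<lambda>z. Re (H z)) ` S"
    using connectedD_interval[of _ "Re (H a)" "Re (H b)" 0] a b ReH by fastforce
  then obtain c where c: "c \<in> S" "Re (H c) = 0" by auto
  \<comment> \<open>Rounding down makes \<open>2 pi k p / p\<close> differ from
    \<open>Im (H c)\<close> by at most \<open>2 pi / p\<close>. The function \<open>F n\<close>
    belongs to the exponent \<open>Suc n\<close>, which is positive.\<close>
  define k where "k p = \<lfloor>real p * Im (H c) / (2 * pi)\<rfloor>" for p
  define F where "F n z = H z - G z / of_nat (Suc n) - \<i> * of_real (2 * pi * of_int (k (Suc n)) / real (Suc n))"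
    for n :: nat and z
  have lim: "(\<lambda>n. 2 * pi * of_int (k (Suc n)) / real (Suc n)) \<longlonglongrightarrow> Im (H c)"
  proof (rule tendsto_sandwich[OF _ _ _ tendsto_const])
    have "2 * pi * of_int (k (Suc n)) / real (Suc n) \<le> Im (H c)" for n
    proof -
      have "real_of_int (k (Suc n)) \<le> real (Suc n) * Im (H c) / (2 * pi)"
        unfolding k_def by linarith
      then show ?thesis by (simp add: field_simps)
    qed
    then show "\<forall>\<^sub>F n in sequentially. 2 * pi * of_int (k (Suc n)) / real (Suc n) \<le> Im (H c)" by simp
    have "Im (H c) - 2 * pi / real (Suc n) \<le> 2 * pi * of_int (k (Suc n)) / real (Suc n)" for n
    proof -
      have "real (Suc n) * Im (H c) / (2 * pi) - 1 \<le> real_of_int (k (Suc n))"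
        unfolding k_def by linarith
      then have "real (Suc n) * Im (H c) - 2 * pi \<le> 2 * pi * of_int (k (Suc n))"
        by (simp add: field_simps)
      then have "(real (Suc n) * Im (H c) - 2 * pi) / real (Suc n) \<le> 2 * pi * of_int (k (Suc n)) / real (Suc n)"
        by (intro divide_right_mono) auto
      then show ?thesis by (simp add: diff_divide_distrib del: of_nat_Suc)
    qed
    then show "\<forall>\<^sub>F n in sequentially. Im (H c) - 2 * pi / real (Suc n) \<le> 2 * pi * of_int (k (Suc n)) / real (Suc n)"
      by simp
    show "(\<lambda>n. Im (H c) - 2 * pi / real (Suc n)) \<longlonglongrightarrow> Im (H c)"
      by real_asymp
  qed
  \<comment> \<open>This absurdity is what Hurwitz's theorem yields at \<open>c\<close> when no
    \<open>F n\<close> has a zero.\<close>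
  have "H c - H c \<noteq> 0"
  proof (rule Hurwitz_no_zeros[of S F "\<lambda>z. H z - H c"])
    show "F n holomorphic_on S" for n
      unfolding F_def using H(1) G(1) by (intro holomorphic_intros) auto
    show "(\<lambda>z. H z - H c) holomorphic_on S"
      using H(1) by (intro holomorphic_intros)
    show "uniform_limit K F (\<lambda>z. H z - H c) sequentially" if K: "compact K" "K \<subseteq> S" for K
    proof -
      have "compact (G ` K)"
        using K holomorphic_on_imp_continuous_on[OF G(1)] continuous_on_subset
        by (intro compact_continuous_image) blast
      then have bd: "bounded (G ` K)" by (rule compact_imp_bounded)
      have inv: "(\<lambda>n. inverse (of_nat (Suc n)) :: complex) \<longlonglongrightarrow> 0"
        by (rule LIMSEQ_Suc[OF lim_inverse_n])
      have "uniform_limit K (\<lambda>n z. H z - inverse (of_nat (Suc n)) * G z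
          - \<i> * of_real (2 * pi * of_int (k (Suc n)) / real (Suc n)))
        (\<lambda>z. H z - 0 * G z - \<i> * of_real (Im (H c))) sequentially"
      proof (intro uniform_limit_minus uniform_limit_const)
        show "uniform_limit K (\<lambda>n z. inverse (of_nat (Suc n)) * G z) (\<lambda>z. 0 * G z) sequentially"
        proof (rule uniform_lim_mult)
          show "bounded ((\<lambda>_. 0 :: complex) ` K)" by (intro boundedI[of _ 0]) auto
          show "uniform_limit K (\<lambda>n _. inverse (of_nat (Suc n)) :: complex) (\<lambda>_. 0) sequentially"
            by (rule uniform_limit_const_fun[OF inv])
        qed (use bd in \<open>auto intro: uniform_limit_const\<close>)
        show "uniform_limit K (\<lambda>n z. \<i> * of_real (2 * pi * of_int (k (Suc n)) / real (Suc n)))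
          (\<lambda>z. \<i> * of_real (Im (H c))) sequentially"
          by (intro uniform_limit_const_fun tendsto_mult tendsto_const tendsto_of_real lim)
      qed
      moreover have "\<i> * of_real (Im (H c)) = H c"
        using c(2) by (simp add: complex_eq_iff)
      ultimately show ?thesis
        unfolding F_def by (simp add: divide_inverse mult.commute)
    qed
    show "\<not> (\<lambda>z. H z - H c) constant_on S"
      using a(1) b(1) ReH unfolding constant_on_def by (metis diff_add_cancel less_asym)
    show "F n z \<noteq> 0" if "z \<in> S" for n z
    proof
      assume 0: "F n z = 0"
      \<comment> \<open>Exponentiating \<open>Suc n * F n z = 0\<close> removes the multiple of
        \<open>2 pi i\<close> and gives a solution with exponent \<open>Suc n\<close>.\<close>
      have "of_nat (Suc n) * F n z = of_nat (Suc n) * H z - G z - \<i> * of_real (2 * pi * of_int (k (Suc n)))"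
        by (simp add: F_def right_diff_distrib del: of_nat_Suc)
      then have "of_nat (Suc n) * H z = G z + \<i> * of_real (2 * pi * of_int (k (Suc n)))"
        using 0 by (simp add: algebra_simps del: of_nat_Suc)
      then have "exp (H z) ^ Suc n = exp (G z) * exp (\<i> * of_real (2 * pi * of_int (k (Suc n))))"
        by (simp only: exp_of_nat_mult[symmetric] exp_add[symmetric])
      then have "exp (H z) ^ Suc n = exp (G z)"
        by (simp only: cis_conv_exp[symmetric]) (simp del: power_Suc)
      then show False
        using no H(2) G(2) that by (metis zero_less_Suc)
    qed
  qed (use S conn c in auto)
  then show False by simp
qed

text \<open>The crossing lemma is applied to \<open>h w = (w ^ s - w) / (w ^ s - 1)\<close> and the
  identity on a small ball. The sign of \<open>|w ^ s - w|^2 - |w ^ s - 1|^2 = |w|^2 - 1 - 2 Re (w ^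
  s * cnj (w - 1))\<close> decides on which side of the unit circle \<open>h w\<close> lies. For
  large \<open>s\<close> the last term dominates at suitable points, and its sign is set by the
  direction of \<open>w ^ s\<close>, which can be prescribed close to \<open>w0\<close>.\<close>

lemma exists_theta_root_near:
  fixes w0 :: complex
  assumes w0: "1 < cmod w0" and e: "0 < e"
  shows "\<exists>w t p. cmod (w - w0) < e \<and> 1 < cmod w \<and> 0 < t \<and> 0 < p \<and>
    (w ^ Suc t - w) ^ p = w * (w ^ Suc t - 1) ^ p"
proof -
  have w1: "0 < cmod (w0 - 1)" using w0 by auto
  \<comment> \<open>The three bounds put the ball within \<open>e\<close> of \<open>w0\<close>, keep
    it outside the unit circle, and keep \<open>w - 1\<close> within half its length of
    \<open>w0 - 1\<close>.\<close>
  define d where "d = min e (min (cmod w0 - 1) (cmod (w0 - 1) / 2))"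
  have d: "0 < d" "d \<le> e" "d \<le> cmod w0 - 1" "d \<le> cmod (w0 - 1) / 2"
    using w0 e w1 unfolding d_def by linarith+
  have large: "1 < cmod w" if "w \<in> ball w0 d" for w
    using that d(3) norm_triangle_ineq2[of w0 w] by (auto simp: dist_norm)
  \<comment> \<open>The first condition on \<open>t\<close> makes the spacing of the
    \<open>s\<close>-th roots less than \<open>d\<close>; the second lets
    \<open>|w0| ^ s * |w0 - 1|\<close> exceed \<open>|w0| ^ 2\<close>.\<close>
  have "\<forall>\<^sub>F t in sequentially. cmod w0 * (2 * pi / real (Suc t)) < d"
    by (rule order_tendstoD(2)[OF _ d(1)]) real_asymp
  moreover have "\<forall>\<^sub>F t in sequentially. cmod w0 ^ Suc t > cmod w0 ^ 2 / cmod (w0 - 1)"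
  proof -
    obtain m where m: "cmod w0 ^ 2 / cmod (w0 - 1) < cmod w0 ^ m"
      using real_arch_pow[OF w0] by blast
    have "cmod w0 ^ 2 / cmod (w0 - 1) < cmod w0 ^ Suc t" if "m \<le> t" for t
      using m power_increasing[of m "Suc t" "cmod w0"] that w0 by linarith
    then show ?thesis by (rule eventually_sequentiallyI)
  qed
  ultimately have "\<forall>\<^sub>F t in sequentially. cmod w0 * (2 * pi / real (Suc t)) < d \<and>
      cmod w0 ^ Suc t > cmod w0 ^ 2 / cmod (w0 - 1) \<and> 0 < t"
    using eventually_gt_at_top[of 0] by eventually_elim auto
  from eventually_happens'[OF sequentially_bot this]
  obtain t where t: "cmod w0 * (2 * pi / real (Suc t)) < d"
      "cmod w0 ^ Suc t > cmod w0 ^ 2 / cmod (w0 - 1)" "0 < t"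
    by blast
  define s where "s = Suc t"
  \<comment> \<open>The direction of \<open>w0 - 1\<close>: with \<open>w ^ s\<close> along
    \<open>u\<close> the real part in the identity is positive, along \<open>- u\<close>
    negative.\<close>
  define u where "u = sgn (w0 - 1)"
  have u: "cmod u = 1" using w1 by (simp add: u_def norm_sgn)
  define h where "h w = (w ^ s - w) / (w ^ s - 1)" for w :: complex
  have nz: "w ^ s - 1 \<noteq> 0" "w ^ s - w \<noteq> 0" "w \<noteq> 0" if "w \<in> ball w0 d" for w
  proof -
    have "1 < cmod (w ^ s)" "1 < cmod (w ^ t)"
      using large[OF that] t(3) by (simp_all add: norm_power s_def one_less_power del: power_Suc)
    moreover have "w ^ s - w = w * (w ^ t - 1)" by (simp add: s_def algebra_simps)
    ultimately show "w ^ s - 1 \<noteq> 0" "w ^ s - w \<noteq> 0" "w \<noteq> 0"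
      using large[OF that] by auto
  qed
  have diff: "cmod (w ^ s - w) ^ 2 - cmod (w ^ s - 1) ^ 2 = cmod w ^ 2 - 1 - 2 * Re (w ^ s * cnj (w - 1))"
    for w
    unfolding cmod_power2 by (simp add: power2_eq_square algebra_simps)
  have near: "\<exists>w\<in>ball w0 d. cmod w = cmod w0 \<and> w ^ s = of_real (cmod w0 ^ s) * v" if v: "cmod v = 1" for v
  proof -
    obtain z where "cmod z = cmod w0" "cmod (z - w0) \<le> cmod w0 * (2 * pi / real s)"
        "z ^ s = of_real (cmod w0 ^ s) * v"
      using exists_nearby_power_eq[OF v, of s w0] unfolding s_def by blast
    then show ?thesis
      using t(1) unfolding s_def[symmetric]
      by (intro bexI[of _ z]) (simp_all add: dist_norm norm_minus_commute)
  qed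
  have re: "cmod (w0 - 1) / 2 \<le> Re (u * cnj (w - 1))" if "w \<in> ball w0 d" for w
  proof -
    have "u * cnj (w0 - 1) = of_real (cmod (w0 - 1))"
    proof -
      have "u * cnj (w0 - 1) = (w0 - 1) * cnj (w0 - 1) / of_real (cmod (w0 - 1))"
        by (simp add: u_def sgn_eq)
      then show ?thesis
        using w1 unfolding complex_norm_square[symmetric] by (simp add: power2_eq_square)
    qed
    then have "Re (u * cnj (w - 1)) = cmod (w0 - 1) + Re (u * cnj (w - w0))"
      by (simp add: algebra_simps)
    moreover have "\<bar>Re (u * cnj (w - w0))\<bar> \<le> d"
    proof -
      have "cmod (u * cnj (w - w0)) = dist w0 w"
        by (simp only: norm_mult u complex_mod_cnj dist_norm norm_minus_commute mult_1)
      then show ?thesis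
        using abs_Re_le_cmod[of "u * cnj (w - w0)"] that by (simp only: mem_ball)
    qed
    ultimately show ?thesis using d(4) by linarith
  qed
  have big: "cmod w0 ^ 2 - 1 < 2 * (cmod w0 ^ s * Re (u * cnj (w - 1)))" if "w \<in> ball w0 d" for w
  proof -
    have "cmod w0 ^ 2 < cmod w0 ^ s * cmod (w0 - 1)"
      using t(2) w1 by (simp add: s_def field_simps)
    also have "\<dots> \<le> 2 * (cmod w0 ^ s * Re (u * cnj (w - 1)))"
      using mult_left_mono[OF re[OF that], of "cmod w0 ^ s"] by simp
    finally show ?thesis by simp
  qed
  obtain a where a: "a \<in> ball w0 d" "cmod a = cmod w0" "a ^ s = of_real (cmod w0 ^ s) * u"
    using near[OF u] by blast
  obtain b where b: "b \<in> ball w0 d" "cmod b = cmod w0" "b ^ s = of_real (cmod w0 ^ s) * (- u)"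
    using near[of "- u"] u by auto
  have "cmod (a ^ s - a) ^ 2 < cmod (a ^ s - 1) ^ 2"
    using diff[of a] big[OF a(1)] a by (simp add: mult.assoc)
  then have "cmod (h a) < 1"
    using nz[OF a(1)] power2_less_imp_less[of "cmod (a ^ s - a)"] by (simp add: h_def norm_divide)
  \<comment> \<open>At \<open>b\<close> signs alone suffice: \<open>|b|^2 - 1\<close> is positive
    and the real part only adds to it.\<close>
  moreover have "cmod (b ^ s - 1) ^ 2 < cmod (b ^ s - b) ^ 2"
  proof -
    have "0 < Re (u * cnj (b - 1))" using re[OF b(1)] w1 by linarith
    then have "0 \<le> cmod w0 ^ s * Re (u * cnj (b - 1))" by simp
    moreover have "Re (b ^ s * cnj (b - 1)) = - (cmod w0 ^ s * Re (u * cnj (b - 1)))"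
      unfolding b(3) by (simp add: algebra_simps)
    moreover have "1 < cmod b ^ 2" using w0 b(2) by (simp add: one_less_power)
    ultimately show ?thesis using diff[of b] by linarith
  qed
  then have "1 < cmod (h b)"
    using nz[OF b(1)] power2_less_imp_less[of "cmod (b ^ s - 1)"] by (simp add: h_def norm_divide)
  ultimately have "\<exists>p>0. \<exists>w\<in>ball w0 d. h w ^ p = w"
  proof (intro exists_power_eq_of_crosses_unit_circle)
    show "h holomorphic_on ball w0 d"
      unfolding h_def using nz by (intro holomorphic_intros) blast+
    show "h w \<noteq> 0" if "w \<in> ball w0 d" for w
      using nz[OF that] by (simp add: h_def)
  qed (use a(1) b(1) nz in \<open>auto intro: holomorphic_intros\<close>)
  then obtain p w where p: "0 < p" "w \<in> ball w0 d" "h w ^ p = w" by blast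
  then have "(w ^ s - w) ^ p = w * (w ^ s - 1) ^ p"
    using nz[OF p(2)] by (simp add: h_def power_divide nonzero_divide_eq_eq)
  then show ?thesis
    using p(1,2) large[OF p(2)] t(3) d(2) unfolding s_def
    by (intro exI[of _ w] exI[of _ t] exI[of _ p]) (auto simp: dist_norm norm_minus_commute)
qed

lemma chromatic_root_add_of_nat:
  "chromatic_root z \<Longrightarrow> chromatic_root (z + of_nat r)"
proof (induction r)
  case (Suc r)
  then show ?case using chromatic_root_add_1[of "z + of_nat r"] by (simp add: ac_simps)
qed simp

theorem theorem1:
  shows "\<exists>A :: complex set. (\<forall>\<alpha>\<in>A. chromatic_root \<alpha>) \<and> closure A = UNIV \<and>
    (\<forall>\<alpha>\<in>A. \<forall>p::nat. p > 0 \<longrightarrow> of_nat p * \<alpha> \<in> A)"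
proof -
  \<comment> \<open>With this choice closure under multiples is immediate and only density needs
    work.\<close>
  define A where "A = {\<alpha>. \<forall>n>0. chromatic_root (of_nat n * \<alpha>)}"
  have "z \<in> closure A" for z
    unfolding closure_approachable
  proof (intro allI impI)
    fix e :: real assume e: "0 < e"
    \<comment> \<open>A large \<open>r\<close> moves \<open>w0\<close> out of the unit disc, while
      \<open>1 - w0 + r = z\<close>.\<close>
    obtain r :: nat where r: "cmod (z - 1) + 1 < of_nat r"
      using reals_Archimedean2 by blast
    define w0 where "w0 = of_nat r - (z - 1)"
    have "1 < cmod w0"
      using norm_triangle_ineq2[of "of_nat r" "z - 1"] r by (simp add: w0_def)
    then obtain w t p where w: "cmod (w - w0) < e" "1 < cmod w" "0 < t"
        "(w ^ Suc t - w) ^ p = w * (w ^ Suc t - 1) ^ p"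
      using exists_theta_root_near[OF _ e] by blast
    have w1: "w \<noteq> 1" using w(2) by auto
    have "chromatic_root (of_nat n * (1 - w + of_nat r))" if n: "0 < n" for n
    proof -
      have "chromatic_root (of_nat n * (1 - w))"
      proof (rule chromatic_rootI[OF finite_theta_verts symp_theta_adj theta_adj_irrefl])
        show "of_nat (card (list_colourings (theta_adj t) (theta_verts n t p) (\<lambda>_. {..<q}))) =
            poly (theta_poly n t p) (of_nat q)" for q :: nat
          using card_list_colourings_theta[of "{..<q}" t n p] w(3) by simp
        show "poly (theta_poly n t p) (of_nat n * (1 - w)) = 0"
          by (rule poly_theta_poly_eq_0[OF w1 n w(4)])
      qed
      \<comment> \<open>The shift must be \<open>n * r\<close>, so that the result is
        \<open>n\<close> times the fixed number \<open>1 - w + r\<close>.\<close>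
      from chromatic_root_add_of_nat[OF this, of "n * r"] show ?thesis
        by (simp add: distrib_left)
    qed
    then have "1 - w + of_nat r \<in> A" by (simp add: A_def)
    moreover have "dist (1 - w + of_nat r) z < e"
      using w(1) by (simp add: w0_def dist_norm norm_minus_commute algebra_simps)
    ultimately show "\<exists>y\<in>A. dist y z < e" by blast
  qed
  then have "closure A = UNIV" by auto
  moreover have "chromatic_root \<alpha>" if "\<alpha> \<in> A" for \<alpha>
    using that by (auto simp: A_def dest: spec[of _ "1 :: nat"])
  moreover have "of_nat p * \<alpha> \<in> A" if "\<alpha> \<in> A" "0 < p" for \<alpha> and p :: nat
    unfolding A_def
  proof (intro CollectI allI impI)
    fix n :: nat assume "0 < n"
    then have "0 < n * p" using that(2) by simp
    then have "chromatic_root (of_nat (n * p) * \<alpha>)" using that(1) unfolding A_def by blast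
    then show "chromatic_root (of_nat n * (of_nat p * \<alpha>))" by (simp add: mult.assoc)
  qed
  ultimately show ?thesis by blast
qed

end
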